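(* Let $\Delta=\Delta_1+\cdots+\Delta_r$ be a centered nef-partition of a reflexive polytope $\Delta\subseteq M_{\mathbb R}$, with dual nef-partition $\nabla_1,\dots,\nabla_r$, and let $\nabla=\nabla_1+\cdots+\nabla_r$. Then $\mathrm{Conv}(\Delta_1,\dots,\Delta_r)$ is a reflexive polytope equal to $\nabla^*$, and $\mathrm{Conv}(\nabla_1,\dots,\nabla_r)=\Delta^*$. Moreover, the Cayley polytope $\Delta_1*\cdots*\Delta_r$ (with respect to the affine lattice $M\times(\mathrm{aff}(e_1,\dots,e_r)\cap\mathbb Z^r)$) and $\mathrm{Conv}(\Delta_1,\dots,\Delta_r)$ (with respect to $M$) have the same $h^*$-polynomial.
   Context: $M\cong\mathbb Z^d$, $N$ dual lattice, pairing $\langle\cdot,\cdot\rangle$. For a lattice polytope $Q$ with $0$ in its interior, $Q^*=\{y:\langle x,y\rangle\ge-1\ \forall x\in Q\}$; $Q$ is reflexive if $Q^*$ is a lattice polytope. A centered nef-partition of a reflexive $\Delta$ is a decomposition $\Delta=\Delta_1+\cdots+\Delta_r$ into lattice polytopes with $0\in\Delta_i$ for all $i$; the dual nef-partition is $\nabla_i:=\{y\in N_{\mathbb R}:\langle x,y\rangle\ge-\delta_{ij}\ \forall x\in\Delta_j,\ \forall j\}$. With $e_1,\dots,e_r$ the standard basis of $\mathbb Z^r$, $\Delta_1*\cdots*\Delta_r=\mathrm{Conv}(\Delta_1\times e_1,\dots,\Delta_r\times e_r)$. For a $k$-dimensional lattice polytope $Q$ (in a given affine lattice), $h^*_Q(t)=(1-t)^{k+1}\sum_{j\ge0}\#(jQ\cap\text{lattice})t^j$.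 *)

theory Defs
  imports "HOL-Analysis.Analysis" "HOL-Computational_Algebra.Formal_Power_Series"
begin

text \<open>The lattice M (and N) is the integer lattice w.r.t. the standard basis of a
Euclidean space; the pairing between M and N is the inner product.\<close>
definition lattice_points :: "'a::euclidean_space set" where
  "lattice_points = {x. \<forall>b\<in>Basis. x \<bullet> b \<in> \<int>}"

definition lattice_polytope :: "'a::euclidean_space set \<Rightarrow> bool" where
  "lattice_polytope P \<longleftrightarrow> (\<exists>S. finite S \<and> S \<subseteq> lattice_points \<and> P = convex hull S)"

definition dual_polytope :: "'a::euclidean_space set \<Rightarrow> 'a set" where
  "dual_polytope Q = {y. \<forall>x\<in>Q. x \<bullet> y \<ge> -1}"

definition reflexive_polytope :: "'a::euclidean_space set \<Rightarrow> bool" where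
  "reflexive_polytope Q \<longleftrightarrow> lattice_polytope Q \<and> 0 \<in> interior Q \<and> lattice_polytope (dual_polytope Q)"

text \<open>Minkowski sum of a finite family of sets.\<close>
definition minkowski_sum :: "('i::finite \<Rightarrow> 'a::euclidean_space set) \<Rightarrow> 'a set" where
  "minkowski_sum A = {\<Sum>i\<in>UNIV. f i | f. \<forall>i. f i \<in> A i}"

definition centered_nef_partition :: "'a::euclidean_space set \<Rightarrow> ('i::finite \<Rightarrow> 'a set) \<Rightarrow> bool" where
  "centered_nef_partition \<Delta> D \<longleftrightarrow> reflexive_polytope \<Delta> \<and>
     (\<forall>i. lattice_polytope (D i) \<and> 0 \<in> D i) \<and> \<Delta> = minkowski_sum D"

definition dual_nef :: "('i::finite \<Rightarrow> 'a::euclidean_space set) \<Rightarrow> 'i \<Rightarrow> 'a set" where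
  "dual_nef D i = {y. \<forall>j. \<forall>x\<in>D j. x \<bullet> y \<ge> - (if i = j then 1 else 0)}"

text \<open>Cayley polytope: Conv(D_1 \<times> e_1, ..., D_r \<times> e_r) in M_R \<times> R^r.\<close>
definition cayley :: "('i::finite \<Rightarrow> 'a::euclidean_space set) \<Rightarrow> ('a \<times> (real^'i)) set" where
  "cayley D = convex hull (\<Union>i. (\<lambda>x. (x, axis i 1)) ` D i)"

text \<open>Ehrhart series: coefficient j is the number of lattice points of jQ.\<close>
definition ehrhart_series :: "'a::euclidean_space set \<Rightarrow> int fps" where
  "ehrhart_series Q = Abs_fps (\<lambda>j. int (card (lattice_points \<inter> (\<lambda>x. real j *\<^sub>R x) ` Q)))"

definition h_star :: "'a::euclidean_space set \<Rightarrow> int fps" where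
  "h_star Q = (1 - fps_X) ^ (nat (aff_dim Q) + 1) * ehrhart_series Q"

end

(*
  Let h_i y be the minimum of <x, y> over x in \<Delta>_i. For a lattice point s of \<Delta>\<^sup>* the h_i s
  are integers \<le> 0 with sum \<ge> -1, so either s = 0 or h_i s = -1 for exactly one i and the
  other h_j s vanish; in particular s lies in \<nabla>_i. Rescaling a vector y onto the boundary of
  \<Delta>\<^sup>* writes it as a nonnegative combination of lattice points of \<Delta>\<^sup>* along which every h_i
  is additive. This decomposition yields Conv(\<nabla>_1, ..., \<nabla>_r) = \<Delta>\<^sup>*, exhibits the \<nabla>_i as
  lattice polytopes, identifies Conv(\<Delta>_1, ..., \<Delta>_r)\<^sup>* with \<nabla>, and shows that for a_i \<ge> 0
  the sum a_1 \<Delta>_1 + ... + a_r \<Delta>_r consists of the m with p_i m \<le> a_i for all i, where p_i m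
  is minus the minimum of <y, m> over y in \<nabla>_i. So a lattice point m lies in
  j Conv(\<Delta>_1, ..., \<Delta>_r) iff p_1 m + ... + p_r m \<le> j, while (m, v) lies in
  j (\<Delta>_1 * ... * \<Delta>_r) iff v_i \<ge> p_i m for all i and v_1 + ... + v_r = j. Both Ehrhart series
  therefore have the same numerator, with denominators (1 - t) and (1 - t)^r, and these are
  cancelled exactly by the dimensions d and d + r - 1.
*)
theory Submission
  imports Defs
begin

lemma sum_UNIV_eq_single:
  fixes f :: "'i::finite \<Rightarrow> 'b::comm_monoid_add"
  shows "(\<And>j. j \<noteq> i \<Longrightarrow> f j = 0) \<Longrightarrow> (\<Sum>j\<in>UNIV. f j) = f i"
  using sum.mono_neutral_right[of UNIV "{i}" f] by auto

lemma sum_scaleR_axis: "(\<Sum>i\<in>UNIV. c i *\<^sub>R axis i 1) = ((\<chi> i. c i) :: real^'n)"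
  using basis_expansion[of "\<chi> i. c i"] by (simp add: scalar_mult_eq_scaleR)

lemma sum_scaleR_Pair_axis:
  "(\<Sum>i\<in>UNIV. c i *\<^sub>R (x i, axis i 1)) = (\<Sum>i\<in>UNIV. c i *\<^sub>R x i, (\<chi> i. c i) :: real^'n)"
  by (simp add: prod_eq_iff fst_sum snd_sum sum_scaleR_axis)

section \<open>Lattice points\<close>

lemma zero_in_lattice_points: "0 \<in> lattice_points"
  unfolding lattice_points_def by simp

lemma sum_in_lattice_points:
  "(\<And>i. i \<in> I \<Longrightarrow> f i \<in> lattice_points) \<Longrightarrow> (\<Sum>i\<in>I. f i) \<in> lattice_points"
  unfolding lattice_points_def by (auto simp: inner_sum_left intro!: Ints_sum)

lemma inner_lattice_points_Ints:
  assumes "x \<in> lattice_points" "y \<in> lattice_points"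
  shows "x \<bullet> y \<in> \<int>"
proof -
  have "x \<bullet> y = (\<Sum>b\<in>Basis. (x \<bullet> b) * (y \<bullet> b))" by (rule euclidean_inner)
  also have "\<dots> \<in> \<int>" using assms unfolding lattice_points_def by (intro Ints_sum Ints_mult) auto
  finally show ?thesis .
qed

lemma Pair_in_lattice_points_iff:
  "(x, v) \<in> lattice_points \<longleftrightarrow> x \<in> lattice_points \<and> v \<in> lattice_points"
  unfolding lattice_points_def Basis_prod_def by (simp add: ball_Un inner_Pair)

lemma vec_in_lattice_points_iff:
  "(v :: real^'n) \<in> lattice_points \<longleftrightarrow> (\<forall>i. v $ i \<in> \<int>)"
  unfolding lattice_points_def Basis_vec_def by (auto simp: inner_axis)

lemma finite_lattice_points_Int_bounded:
  assumes "bounded B"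
  shows "finite (lattice_points \<inter> B)"
proof -
  obtain R where R: "\<And>x. x \<in> B \<Longrightarrow> norm x \<le> R" using assms bounded_iff by blast
  define K where "K = (of_int ` {-\<lceil>R\<rceil>..\<lceil>R\<rceil>} :: real set)"
  have "x \<bullet> b \<in> K" if "x \<in> lattice_points" "x \<in> B" "b \<in> Basis" for x :: 'a and b
  proof -
    have "x \<bullet> b \<in> \<int>" using that unfolding lattice_points_def by blast
    then obtain k where k: "x \<bullet> b = of_int k" by (auto elim: Ints_cases)
    have "\<bar>x \<bullet> b\<bar> \<le> R" using Basis_le_norm[OF \<open>b \<in> Basis\<close>, of x] R[OF \<open>x \<in> B\<close>] by linarith
    then have "\<bar>k\<bar> \<le> \<lceil>R\<rceil>" using k by linarith
    then show ?thesis unfolding K_def k by (intro imageI) (simp add: abs_le_iff)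
  qed
  then have "lattice_points \<inter> B \<subseteq> (\<Sum>b\<in>Basis. (\<lambda>t. t *\<^sub>R b) ` K)"
    unfolding box_eq_set_sum_Basis[symmetric] by blast
  moreover have "finite (\<Sum>b\<in>(Basis::'a set). (\<lambda>t. t *\<^sub>R b) ` K)"
    unfolding K_def by (intro finite_set_sum) simp
  ultimately show ?thesis by (rule finite_subset)
qed

section \<open>Lower support functions\<close>

text \<open>Only used for compact nonempty \<open>P\<close>, where the infimum is attained.\<close>
definition lower_support :: "'a::euclidean_space set \<Rightarrow> 'a \<Rightarrow> real" where
  "lower_support P y = Inf ((\<lambda>x. x \<bullet> y) ` P)"

lemma lower_support_eqI:
  "x \<in> P \<Longrightarrow> (\<And>z. z \<in> P \<Longrightarrow> x \<bullet> y \<le> z \<bullet> y) \<Longrightarrow> lower_support P y = x \<bullet> y"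
  unfolding lower_support_def by (rule cInf_eq_minimum) auto

lemma lower_support_minimizer:
  assumes "compact P" "P \<noteq> {}"
  shows "\<exists>x\<in>P. lower_support P y = x \<bullet> y \<and> (\<forall>z\<in>P. x \<bullet> y \<le> z \<bullet> y)"
proof -
  have "continuous_on P (\<lambda>x. x \<bullet> y)" by (intro continuous_intros)
  then obtain x where "x \<in> P" "\<forall>z\<in>P. x \<bullet> y \<le> z \<bullet> y"
    using continuous_attains_inf[OF assms] by blast
  then show ?thesis using lower_support_eqI by blast
qed

lemma lower_support_le:
  assumes "compact P" "x \<in> P"
  shows "lower_support P y \<le> x \<bullet> y"
proof -
  obtain x0 where "lower_support P y = x0 \<bullet> y" "\<forall>z\<in>P. x0 \<bullet> y \<le> z \<bullet> y"
    using lower_support_minimizer[OF assms(1), of y] assms(2) by blast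
  then show ?thesis using assms(2) by simp
qed

lemma lower_support_attained:
  "compact P \<Longrightarrow> P \<noteq> {} \<Longrightarrow> \<exists>x\<in>P. x \<bullet> y = lower_support P y"
  using lower_support_minimizer by (metis (no_types, lifting))

lemma lower_support_ge_iff:
  "compact P \<Longrightarrow> P \<noteq> {} \<Longrightarrow> (\<forall>x\<in>P. c \<le> x \<bullet> y) \<longleftrightarrow> c \<le> lower_support P y"
  by (metis lower_support_attained lower_support_le order_trans)

lemma lower_support_nonpos: "compact P \<Longrightarrow> 0 \<in> P \<Longrightarrow> lower_support P y \<le> 0"
  using lower_support_le[of P 0 y] by simp

lemma lower_support_zero: "P \<noteq> {} \<Longrightarrow> lower_support P 0 = 0"
  by (metis ex_in_conv inner_zero_right lower_support_eqI order_refl)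

lemma lower_support_sum_ge:
  assumes "compact P" "P \<noteq> {}" "\<And>k. k \<in> K \<Longrightarrow> 0 \<le> c k"
  shows "(\<Sum>k\<in>K. c k * lower_support P (v k)) \<le> lower_support P (\<Sum>k\<in>K. c k *\<^sub>R v k)"
proof -
  obtain x where x: "x \<in> P" "lower_support P (\<Sum>k\<in>K. c k *\<^sub>R v k) = x \<bullet> (\<Sum>k\<in>K. c k *\<^sub>R v k)"
    using lower_support_minimizer[OF assms(1,2)] by blast
  have "(\<Sum>k\<in>K. c k * lower_support P (v k)) \<le> (\<Sum>k\<in>K. c k * (x \<bullet> v k))"
    by (intro sum_mono mult_left_mono lower_support_le assms x(1))
  also have "\<dots> = x \<bullet> (\<Sum>k\<in>K. c k *\<^sub>R v k)" by (simp add: inner_sum_right)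
  finally show ?thesis using x(2) by simp
qed

lemma lower_support_scaleR:
  assumes "compact P" "P \<noteq> {}" "0 \<le> c"
  shows "lower_support P (c *\<^sub>R y) = c * lower_support P y"
proof (rule antisym)
  obtain x where "x \<in> P" "lower_support P y = x \<bullet> y"
    using lower_support_minimizer[OF assms(1,2)] by blast
  then show "lower_support P (c *\<^sub>R y) \<le> c * lower_support P y"
    using lower_support_le[OF assms(1), of x "c *\<^sub>R y"] by simp
  show "c * lower_support P y \<le> lower_support P (c *\<^sub>R y)"
    using lower_support_sum_ge[OF assms(1,2), of "{()}" "\<lambda>_. c" "\<lambda>_. y"] assms(3) by simp
qed

lemma lattice_polytope_imp_polytope: "lattice_polytope P \<Longrightarrow> polytope P"
  unfolding lattice_polytope_def polytope_def by blast

lemma lattice_polytope_imp_compact: "lattice_polytope P \<Longrightarrow> compact P"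
  by (simp add: lattice_polytope_imp_polytope polytope_imp_compact)

lemma lattice_polytope_imp_convex: "lattice_polytope P \<Longrightarrow> convex P"
  by (simp add: lattice_polytope_imp_polytope polytope_imp_convex)

text \<open>The minimum of a lattice functional over a lattice polytope is attained at a vertex.\<close>
lemma lower_support_lattice_polytope_Ints:
  assumes "lattice_polytope P" "P \<noteq> {}" "y \<in> lattice_points"
  shows "lower_support P y \<in> \<int>"
proof -
  obtain S where S: "finite S" "S \<subseteq> lattice_points" "P = convex hull S"
    using assms(1) unfolding lattice_polytope_def by blast
  obtain s where s: "s \<in> S" "\<And>z. z \<in> S \<Longrightarrow> s \<bullet> y \<le> z \<bullet> y"
    using ex_is_arg_min_if_finite[of S "\<lambda>x. x \<bullet> y"] S(1,3) assms(2)
    by (auto simp: is_arg_min_linorder)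
  have "convex {z. s \<bullet> y \<le> z \<bullet> y}"
    using convex_halfspace_ge[of "s \<bullet> y" y] by (simp add: inner_commute)
  then have "P \<subseteq> {z. s \<bullet> y \<le> z \<bullet> y}" unfolding S(3) by (rule hull_minimal[rotated]) (use s in auto)
  then have "lower_support P y = s \<bullet> y"
    using s(1) S(3) by (intro lower_support_eqI) (auto intro: hull_inc)
  then show ?thesis using inner_lattice_points_Ints s(1) S(2) assms(3) by auto
qed

section \<open>Dual polytopes\<close>

lemma mem_dual_polytope_iff:
  "compact P \<Longrightarrow> P \<noteq> {} \<Longrightarrow> y \<in> dual_polytope P \<longleftrightarrow> -1 \<le> lower_support P y"
  unfolding dual_polytope_def using lower_support_ge_iff by blast

lemma convex_dual_polytope: "convex (dual_polytope Q)"
proof -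
  have "dual_polytope Q = (\<Inter>x\<in>Q. {y. x \<bullet> y \<ge> -1})" unfolding dual_polytope_def by blast
  then show ?thesis by (simp add: convex_INT convex_halfspace_ge)
qed

lemma dual_polytope_convex_hull: "dual_polytope (convex hull A) = dual_polytope A"
proof
  show "dual_polytope (convex hull A) \<subseteq> dual_polytope A"
    unfolding dual_polytope_def using hull_subset[of A convex] by blast
  show "dual_polytope A \<subseteq> dual_polytope (convex hull A)"
  proof
    fix y assume y: "y \<in> dual_polytope A"
    have "convex {x. -1 \<le> x \<bullet> y}"
      using convex_halfspace_ge[of "-1" y] by (simp add: inner_commute)
    then have "convex hull A \<subseteq> {x. -1 \<le> x \<bullet> y}"
      by (rule hull_minimal[rotated]) (use y in \<open>auto simp: dual_polytope_def\<close>)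
    then show "y \<in> dual_polytope (convex hull A)" unfolding dual_polytope_def by auto
  qed
qed

lemma dual_dual_polytope:
  assumes "convex Q" "closed Q" "0 \<in> Q"
  shows "dual_polytope (dual_polytope Q) = Q"
proof
  show "Q \<subseteq> dual_polytope (dual_polytope Q)"
    unfolding dual_polytope_def by (auto simp: inner_commute)
  show "dual_polytope (dual_polytope Q) \<subseteq> Q"
  proof
    fix x assume x: "x \<in> dual_polytope (dual_polytope Q)"
    show "x \<in> Q"
    proof (rule ccontr)
      assume "x \<notin> Q"
      then obtain a b where ab: "a \<bullet> x < b" "\<And>z. z \<in> Q \<Longrightarrow> b < a \<bullet> z"
        using separating_hyperplane_closed_point[OF assms(1,2)] by blast
      have b: "b < 0" using ab(2)[OF assms(3)] by simp
      define y where "y = (- 1 / b) *\<^sub>R a"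
      have "-1 \<le> z \<bullet> y" if "z \<in> Q" for z
        using ab(2)[OF that] b unfolding y_def by (simp add: inner_commute field_simps)
      then have "y \<in> dual_polytope Q" unfolding dual_polytope_def by blast
      then have "-1 \<le> y \<bullet> x" using x unfolding dual_polytope_def by blast
      moreover have "x \<bullet> y < -1" using ab(1) b unfolding y_def by (simp add: inner_commute field_simps)
      ultimately show False by (simp add: inner_commute)
    qed
  qed
qed

lemma mem_dual_nef_iff:
  assumes "\<And>j. compact (D j)" "\<And>j. D j \<noteq> {}"
  shows "y \<in> dual_nef D i \<longleftrightarrow> (\<forall>j. - (if i = j then 1 else 0) \<le> lower_support (D j) y)"
  unfolding dual_nef_def using lower_support_ge_iff[OF assms] by blast

lemma convex_dual_nef: "convex (dual_nef D i)"
proof -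
  have "dual_nef D i = (\<Inter>j. \<Inter>x\<in>D j. {y. x \<bullet> y \<ge> - (if i = j then 1 else 0)})"
    unfolding dual_nef_def by blast
  then show ?thesis by (simp add: convex_INT convex_halfspace_ge)
qed

lemma zero_in_dual_nef: "0 \<in> dual_nef D i"
  unfolding dual_nef_def by simp

section \<open>Convex hulls and Minkowski sums\<close>

lemma convex_hull_Union_convex_hull:
  "convex hull (\<Union>i. convex hull (F i)) = convex hull (\<Union>i. F i)"
proof (rule antisym)
  show "convex hull (\<Union>i. convex hull F i) \<subseteq> convex hull (\<Union>i. F i)"
    by (intro hull_minimal) (auto intro: hull_mono[THEN subsetD])
  show "convex hull (\<Union>i. F i) \<subseteq> convex hull (\<Union>i. convex hull F i)"
    by (intro hull_mono) (auto intro: hull_inc)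
qed

lemma lattice_polytope_convex_hull_Union:
  fixes P :: "'i::finite \<Rightarrow> 'a::euclidean_space set"
  assumes "\<And>i. lattice_polytope (P i)"
  shows "lattice_polytope (convex hull (\<Union>i. P i))"
proof -
  have "\<forall>i. \<exists>F. finite F \<and> F \<subseteq> lattice_points \<and> P i = convex hull F"
    using assms unfolding lattice_polytope_def by blast
  from choice[OF this] obtain F
    where F: "\<And>i. finite (F i)" "\<And>i. F i \<subseteq> lattice_points" "\<And>i. P i = convex hull F i" by blast
  have "convex hull (\<Union>i. P i) = convex hull (\<Union>i. F i)"
    unfolding F(3) by (rule convex_hull_Union_convex_hull)
  then show ?thesis unfolding lattice_polytope_def
    by (intro exI[of _ "\<Union>i. F i"]) (use F(1,2) in auto)
qed

lemma convex_sum_le_one_mem: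
  assumes K: "convex K" "0 \<in> K" and A: "finite A" and l: "\<And>a. a \<in> A \<Longrightarrow> 0 \<le> l a"
    and L: "sum l A \<le> 1" and v: "\<And>a. a \<in> A \<Longrightarrow> v a \<in> K"
  shows "(\<Sum>a\<in>A. l a *\<^sub>R v a) \<in> K"
proof (cases "sum l A = 0")
  case True
  then have "\<forall>a\<in>A. l a = 0" using sum_nonneg_eq_0_iff[OF A] l by blast
  then show ?thesis using K(2) by simp
next
  case False
  define s where "s = sum l A"
  have s: "0 < s" using False l sum_nonneg[of A l] unfolding s_def by force
  have "(\<Sum>a\<in>A. (l a / s) *\<^sub>R v a) \<in> K"
  proof (rule convex_sum[OF A K(1)])
    show "(\<Sum>a\<in>A. l a / s) = 1" using s unfolding s_def by (simp add: sum_divide_distrib[symmetric])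
  qed (use l s v in auto)
  then have "s *\<^sub>R (\<Sum>a\<in>A. (l a / s) *\<^sub>R v a) + (1 - s) *\<^sub>R 0 \<in> K"
    using convexD[OF K(1) _ K(2), of _ s "1 - s"] s L unfolding s_def by auto
  moreover have "s *\<^sub>R (\<Sum>a\<in>A. (l a / s) *\<^sub>R v a) = (\<Sum>a\<in>A. l a *\<^sub>R v a)"
    using s by (simp add: scaleR_sum_right)
  ultimately show ?thesis by simp
qed

lemma weighted_sums_zero:
  fixes K :: "'i::finite \<Rightarrow> 'a::real_vector set"
  assumes "\<And>i. K i \<noteq> {}"
  shows "{\<Sum>i\<in>UNIV. a i *\<^sub>R x i | a x. (\<forall>i. 0 \<le> a i) \<and> sum a UNIV = 0 \<and> (\<forall>i. x i \<in> K i)} = {0}"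
    (is "?R = _")
proof
  show "?R \<subseteq> {0}"
  proof
    fix p assume "p \<in> ?R"
    then obtain a :: "'i \<Rightarrow> real" and x where a: "\<forall>i. 0 \<le> a i" "sum a UNIV = 0"
      and p: "p = (\<Sum>i\<in>UNIV. a i *\<^sub>R x i)" by blast
    have "\<forall>i. a i = 0" using a by (simp add: sum_nonneg_eq_0_iff)
    then show "p \<in> {0}" unfolding p by simp
  qed
  have "\<forall>i. \<exists>x. x \<in> K i" using assms by blast
  then obtain x where "\<And>i. x i \<in> K i" by metis
  then show "{0} \<subseteq> ?R" by (intro subsetI CollectI exI[of _ "\<lambda>_. 0"] exI[of _ x]) simp
qed

lemma scaleR_weighted_sums:
  fixes K :: "'i::finite \<Rightarrow> 'a::real_vector set"
  assumes t: "0 < t"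
  shows "(*\<^sub>R) t ` {\<Sum>i\<in>UNIV. c i *\<^sub>R x i | c x. (\<forall>i. 0 \<le> c i) \<and> sum c UNIV = 1 \<and> (\<forall>i. x i \<in> K i)}
    = {\<Sum>i\<in>UNIV. a i *\<^sub>R x i | a x. (\<forall>i. 0 \<le> a i) \<and> sum a UNIV = t \<and> (\<forall>i. x i \<in> K i)}"
    (is "_ ` ?R 1 = ?R t")
proof
  show "(*\<^sub>R) t ` ?R 1 \<subseteq> ?R t"
  proof
    fix p assume "p \<in> (*\<^sub>R) t ` ?R 1"
    then obtain c :: "'i \<Rightarrow> real" and x where c: "\<forall>i. 0 \<le> c i" "sum c UNIV = 1" "\<forall>i. x i \<in> K i"
      and p: "p = t *\<^sub>R (\<Sum>i\<in>UNIV. c i *\<^sub>R x i)" by blast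
    show "p \<in> ?R t"
    proof (intro CollectI exI conjI)
      show "p = (\<Sum>i\<in>UNIV. (t * c i) *\<^sub>R x i)" unfolding p by (simp add: scaleR_sum_right)
      show "(\<Sum>i\<in>UNIV. t * c i) = t" using c(2) by (simp add: sum_distrib_left[symmetric])
    qed (use c t in auto)
  qed
  show "?R t \<subseteq> (*\<^sub>R) t ` ?R 1"
  proof
    fix p assume "p \<in> ?R t"
    then obtain a :: "'i \<Rightarrow> real" and x where a: "\<forall>i. 0 \<le> a i" "sum a UNIV = t" "\<forall>i. x i \<in> K i"
      and p: "p = (\<Sum>i\<in>UNIV. a i *\<^sub>R x i)" by blast
    have "(\<Sum>i\<in>UNIV. (a i / t) *\<^sub>R x i) \<in> ?R 1"
    proof (intro CollectI exI conjI)
      show "(\<Sum>i\<in>UNIV. a i / t) = 1" using a(2) t by (simp add: sum_divide_distrib[symmetric])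
    qed (use a t in auto)
    moreover have "p = t *\<^sub>R (\<Sum>i\<in>UNIV. (a i / t) *\<^sub>R x i)"
      unfolding p using t by (simp add: scaleR_sum_right)
    ultimately show "p \<in> (*\<^sub>R) t ` ?R 1" by (rule rev_image_eqI)
  qed
qed

lemma scaleR_convex_hull_Union:
  fixes K :: "'i::finite \<Rightarrow> 'a::real_vector set"
  assumes "\<And>i. convex (K i)" "\<And>i. K i \<noteq> {}" "0 \<le> t"
  shows "(*\<^sub>R) t ` (convex hull (\<Union>i. K i))
    = {\<Sum>i\<in>UNIV. a i *\<^sub>R x i | a x. (\<forall>i. 0 \<le> a i) \<and> sum a UNIV = t \<and> (\<forall>i. x i \<in> K i)}"
proof (cases "t = 0")
  case True
  have "convex hull (\<Union>i. K i) \<noteq> {}" using assms(2) by simp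
  then show ?thesis using True weighted_sums_zero[where K = K, OF assms(2)] by (simp add: image_constant_conv)
next
  case False
  have "convex hull (\<Union>i. K i)
      = {\<Sum>i\<in>UNIV. c i *\<^sub>R x i | c x. (\<forall>i. 0 \<le> c i) \<and> sum c UNIV = 1 \<and> (\<forall>i. x i \<in> K i)}"
    using convex_hull_finite_union[of UNIV K] assms(1,2) by simp
  then show ?thesis using False assms(3) scaleR_weighted_sums[of t K] by simp
qed

lemma minkowski_sum_eq_set_sum: "minkowski_sum A = (\<Sum>i\<in>UNIV. A i)"
  unfolding minkowski_sum_def by (simp add: set_sum_alt)

lemma minkowski_sum_convex_hull:
  "minkowski_sum (\<lambda>i. convex hull (F i)) = convex hull (minkowski_sum F)"
  unfolding minkowski_sum_eq_set_sum by (simp add: convex_hull_set_sum)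

lemma finite_minkowski_sum: "(\<And>i. finite (F i)) \<Longrightarrow> finite (minkowski_sum F)"
  unfolding minkowski_sum_eq_set_sum by (simp add: finite_set_sum)

lemma polytope_minkowski_sum:
  assumes "\<And>i. polytope (P i)"
  shows "polytope (minkowski_sum P)"
proof -
  have "\<forall>i. \<exists>F. finite F \<and> P i = convex hull F" using assms unfolding polytope_def by blast
  from choice[OF this] obtain F where F: "\<And>i. finite (F i)" "\<And>i. P i = convex hull F i"
    by blast
  have P: "P = (\<lambda>i. convex hull F i)" by (intro ext F(2))
  show ?thesis unfolding P minkowski_sum_convex_hull
    by (intro polytope_convex_hull finite_minkowski_sum F(1))
qed

lemma lattice_polytope_minkowski_sum:
  assumes "\<And>i. lattice_polytope (P i)"
  shows "lattice_polytope (minkowski_sum P)"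
proof -
  have "\<forall>i. \<exists>F. finite F \<and> F \<subseteq> lattice_points \<and> P i = convex hull F"
    using assms unfolding lattice_polytope_def by blast
  from choice[OF this] obtain F
    where F: "\<And>i. finite (F i)" "\<And>i. F i \<subseteq> lattice_points" "\<And>i. P i = convex hull F i"
    by blast
  have P: "P = (\<lambda>i. convex hull F i)" by (intro ext F(3))
  have "minkowski_sum F \<subseteq> lattice_points"
    using F(2) unfolding minkowski_sum_def by (auto intro!: sum_in_lattice_points)
  then show ?thesis unfolding lattice_polytope_def P minkowski_sum_convex_hull
    using finite_minkowski_sum[OF F(1)] by (intro exI[of _ "minkowski_sum F"]) simp
qed

lemma lower_support_minkowski_sum:
  assumes "\<And>i. compact (A i)" "\<And>i. A i \<noteq> {}"
  shows "lower_support (minkowski_sum A) y = (\<Sum>i\<in>UNIV. lower_support (A i) y)"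
proof -
  have "\<forall>i. \<exists>x. x \<in> A i \<and> lower_support (A i) y = x \<bullet> y \<and> (\<forall>z\<in>A i. x \<bullet> y \<le> z \<bullet> y)"
    using lower_support_minimizer[OF assms(1,2)] by blast
  from choice[OF this] obtain x where x: "\<And>i. x i \<in> A i" "\<And>i. lower_support (A i) y = x i \<bullet> y"
    "\<And>i z. z \<in> A i \<Longrightarrow> x i \<bullet> y \<le> z \<bullet> y" by blast
  have "lower_support (minkowski_sum A) y = (\<Sum>i\<in>UNIV. x i) \<bullet> y"
  proof (rule lower_support_eqI)
    show "(\<Sum>i\<in>UNIV. x i) \<in> minkowski_sum A" unfolding minkowski_sum_def using x(1) by blast
    fix z assume "z \<in> minkowski_sum A"
    then obtain f where "z = (\<Sum>i\<in>UNIV. f i)" "\<And>i. f i \<in> A i" unfolding minkowski_sum_def by blast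
    then show "(\<Sum>i\<in>UNIV. x i) \<bullet> y \<le> z \<bullet> y"
      by (simp add: inner_sum_left sum_mono x(3))
  qed
  then show ?thesis by (simp add: inner_sum_left x(2))
qed

lemma mem_minkowski_sum_scaleR_iff:
  "m \<in> minkowski_sum (\<lambda>i. (*\<^sub>R) (a i) ` A i) \<longleftrightarrow> (\<exists>x. (\<forall>i. x i \<in> A i) \<and> m = (\<Sum>i\<in>UNIV. a i *\<^sub>R x i))"
proof
  assume "m \<in> minkowski_sum (\<lambda>i. (*\<^sub>R) (a i) ` A i)"
  then obtain f where m: "m = (\<Sum>i\<in>UNIV. f i)" and f: "\<forall>i. \<exists>x\<in>A i. f i = a i *\<^sub>R x"
    unfolding minkowski_sum_def by blast
  from f obtain x where "\<And>i. x i \<in> A i" "\<And>i. f i = a i *\<^sub>R x i" by metis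
  then show "\<exists>x. (\<forall>i. x i \<in> A i) \<and> m = (\<Sum>i\<in>UNIV. a i *\<^sub>R x i)" using m by auto
next
  assume "\<exists>x. (\<forall>i. x i \<in> A i) \<and> m = (\<Sum>i\<in>UNIV. a i *\<^sub>R x i)"
  then show "m \<in> minkowski_sum (\<lambda>i. (*\<^sub>R) (a i) ` A i)" unfolding minkowski_sum_def by blast
qed

lemma weighted_sums_image:
  "{\<Sum>i\<in>UNIV. a i *\<^sub>R p i | a p. (\<forall>i. 0 \<le> a i) \<and> sum a UNIV = t \<and> (\<forall>i. p i \<in> g i ` A i)}
    = {\<Sum>i\<in>UNIV. a i *\<^sub>R g i (x i) | a x. (\<forall>i. 0 \<le> a i) \<and> sum a UNIV = t \<and> (\<forall>i. x i \<in> A i)}"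
proof (intro set_eqI iffI)
  fix q
  assume "q \<in> {\<Sum>i\<in>UNIV. a i *\<^sub>R p i | a p. (\<forall>i. 0 \<le> a i) \<and> sum a UNIV = t \<and> (\<forall>i. p i \<in> g i ` A i)}"
  then obtain a p where a: "\<forall>i. 0 \<le> a i" "sum a UNIV = t"
    and p: "\<forall>i. \<exists>x. x \<in> A i \<and> p i = g i x" and q: "q = (\<Sum>i\<in>UNIV. a i *\<^sub>R p i)"
    by blast
  from choice[OF p] obtain x where "\<And>i. x i \<in> A i" "\<And>i. p i = g i (x i)" by blast
  then show "q \<in> {\<Sum>i\<in>UNIV. a i *\<^sub>R g i (x i) | a x.
      (\<forall>i. 0 \<le> a i) \<and> sum a UNIV = t \<and> (\<forall>i. x i \<in> A i)}"
    using a unfolding q by auto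
next
  fix q
  assume "q \<in> {\<Sum>i\<in>UNIV. a i *\<^sub>R g i (x i) | a x.
      (\<forall>i. 0 \<le> a i) \<and> sum a UNIV = t \<and> (\<forall>i. x i \<in> A i)}"
  then obtain a x where "\<forall>i. 0 \<le> a i" "sum a UNIV = t" "\<forall>i. x i \<in> A i"
    and "q = (\<Sum>i\<in>UNIV. a i *\<^sub>R g i (x i))" by blast
  then show "q \<in> {\<Sum>i\<in>UNIV. a i *\<^sub>R p i | a p. (\<forall>i. 0 \<le> a i) \<and> sum a UNIV = t \<and> (\<forall>i. p i \<in> g i ` A i)}"
    by (intro CollectI exI[of _ a] exI[of _ "\<lambda>i. g i (x i)"]) auto
qed

lemma mem_affine_add_sum_diffs:
  assumes "affine S" "x \<in> S" "z \<in> S" "finite I" "\<And>i. i \<in> I \<Longrightarrow> y i \<in> S"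
  shows "x + (\<Sum>i\<in>I. c i *\<^sub>R (y i - z)) \<in> S"
  using assms(4,5)
proof (induction I rule: finite_induct)
  case empty
  then show ?case using assms(2) by simp
next
  case (insert a I)
  then have "(x + (\<Sum>i\<in>I. c i *\<^sub>R (y i - z))) + c a *\<^sub>R (y a - z) \<in> S"
    by (intro mem_affine_3_minus assms(1,3)) auto
  then show ?case using insert(1,2) by (simp add: add_ac)
qed

lemma zero_in_interior_absorbing:
  fixes S :: "'a::real_normed_vector set"
  assumes "0 \<in> interior S"
  obtains c where "0 < c" "c *\<^sub>R z \<in> S"
proof -
  obtain e where e: "0 < e" "ball 0 e \<subseteq> S" using assms mem_interior by blast
  define c where "c = e / (norm z + 1)"
  have "0 < norm z + 1" by (simp add: add_nonneg_pos)
  then have "0 < c" "norm (c *\<^sub>R z) < e" using e(1) by (simp_all add: c_def pos_divide_less_eq)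
  then show thesis using that[of c] e(2) by (simp add: subset_iff)
qed

section \<open>Weak compositions\<close>

definition weak_compositions :: "'i set \<Rightarrow> nat \<Rightarrow> ('i \<Rightarrow> nat) set" where
  "weak_compositions I n = {c. (\<forall>i. i \<notin> I \<longrightarrow> c i = 0) \<and> sum c I = n}"

lemma weak_compositions_empty: "weak_compositions {} n = (if n = 0 then {\<lambda>_. 0} else {})"
  unfolding weak_compositions_def by auto

lemma weak_compositions_insert:
  assumes "finite I" "a \<notin> I"
  shows "weak_compositions (insert a I) n
    = (\<lambda>(k, c). c(a := k)) ` (SIGMA k:{..n}. weak_compositions I (n - k))"
proof
  show "(\<lambda>(k, c). c(a := k)) ` (SIGMA k:{..n}. weak_compositions I (n - k)) \<subseteq> weak_compositions (insert a I) n"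
  proof
    fix d assume "d \<in> (\<lambda>(k, c). c(a := k)) ` (SIGMA k:{..n}. weak_compositions I (n - k))"
    then obtain k c where k: "k \<le> n" and c: "c \<in> weak_compositions I (n - k)" and d: "d = c(a := k)"
      by auto
    have "sum (c(a := k)) I = sum c I" using assms(2) by (intro sum.cong) auto
    then show "d \<in> weak_compositions (insert a I) n"
      using assms k c unfolding d weak_compositions_def by auto
  qed
  show "weak_compositions (insert a I) n \<subseteq> (\<lambda>(k, c). c(a := k)) ` (SIGMA k:{..n}. weak_compositions I (n - k))"
  proof
    fix c assume c: "c \<in> weak_compositions (insert a I) n"
    then have n: "c a + sum c I = n" using assms unfolding weak_compositions_def by auto
    have "sum (c(a := 0)) I = sum c I" using assms(2) by (intro sum.cong) auto
    then have "c(a := 0) \<in> weak_compositions I (n - c a)"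
      using c n unfolding weak_compositions_def by auto
    then show "c \<in> (\<lambda>(k, c). c(a := k)) ` (SIGMA k:{..n}. weak_compositions I (n - k))"
      using n by (intro rev_image_eqI[of "(c a, c(a := 0))"]) auto
  qed
qed

lemma finite_weak_compositions: "finite I \<Longrightarrow> finite (weak_compositions I n)"
proof (induction I arbitrary: n rule: finite_induct)
  case empty
  then show ?case by (simp add: weak_compositions_empty)
next
  case (insert a I)
  then show ?case by (simp add: weak_compositions_insert)
qed

lemma card_weak_compositions_insert:
  assumes "finite I" "a \<notin> I"
  shows "card (weak_compositions (insert a I) n) = (\<Sum>k\<le>n. card (weak_compositions I (n - k)))"
proof -
  have "inj_on (\<lambda>(k, c). c(a := k)) (SIGMA k:{..n}. weak_compositions I (n - k))"
  proof (rule inj_onI, clarify)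
    fix k c k' c'
    assume c: "c \<in> weak_compositions I (n - k)" and c': "c' \<in> weak_compositions I (n - k')"
      and eq: "c(a := k) = c'(a := k')"
    have "c a = 0" "c' a = 0" using c c' assms(2) unfolding weak_compositions_def by auto
    then show "k = k' \<and> c = c'" using eq by (metis fun_upd_same fun_upd_upd fun_upd_triv)
  qed
  then show ?thesis
    unfolding weak_compositions_insert[OF assms]
    by (simp add: card_image card_SigmaI finite_weak_compositions assms(1))
qed

lemma fps_card_weak_compositions:
  "finite I \<Longrightarrow> Abs_fps (\<lambda>n. int (card (weak_compositions I n))) = Abs_fps (\<lambda>_. 1) ^ card I"
proof (induction I rule: finite_induct)
  case empty
  then show ?case by (intro fps_ext) (simp add: weak_compositions_empty)
next
  case (insert a I)
  have "Abs_fps (\<lambda>n. int (card (weak_compositions (insert a I) n)))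
      = Abs_fps (\<lambda>_. 1) * Abs_fps (\<lambda>n. int (card (weak_compositions I n)))"
    by (intro fps_ext) (simp add: fps_mult_nth card_weak_compositions_insert insert(1,2)
        atLeast0AtMost sum.atLeastAtMost_rev[of _ 0 _, simplified])
  then show ?case using insert by simp
qed

lemma one_minus_X_mult_ones: "(1 - fps_X) * Abs_fps (\<lambda>_. 1 :: int) = 1"
proof (rule fps_ext)
  fix n
  show "fps_nth ((1 - fps_X) * Abs_fps (\<lambda>_. 1 :: int)) n = fps_nth 1 n"
    by (simp add: algebra_simps)
qed

section \<open>Centered nef-partitions and their duals\<close>

locale nef_partition =
  fixes \<Delta> :: "'a::euclidean_space set" and D :: "'r::finite \<Rightarrow> 'a set"
  assumes centered: "centered_nef_partition \<Delta> D"
begin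

abbreviation C :: "'a set" where "C \<equiv> convex hull (\<Union>i. D i)"

abbreviation nabla :: "'r \<Rightarrow> 'a set" where "nabla \<equiv> dual_nef D"

abbreviation supp :: "'r \<Rightarrow> 'a \<Rightarrow> real" where "supp i \<equiv> lower_support (D i)"

lemma reflexive_Delta: "reflexive_polytope \<Delta>"
  and lattice_polytope_D: "lattice_polytope (D i)"
  and zero_in_D: "0 \<in> D i"
  and Delta_eq: "\<Delta> = minkowski_sum D"
  using centered unfolding centered_nef_partition_def by auto

lemma compact_D: "compact (D i)"
  by (rule lattice_polytope_imp_compact[OF lattice_polytope_D])

lemma D_nonempty: "D i \<noteq> {}"
  using zero_in_D by blast

lemma convex_D: "convex (D i)"
  by (rule lattice_polytope_imp_convex[OF lattice_polytope_D])

lemma zero_in_interior_Delta: "0 \<in> interior \<Delta>"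
  using reflexive_Delta unfolding reflexive_polytope_def by blast

lemma supp_nonpos: "supp i y \<le> 0"
  by (rule lower_support_nonpos[OF compact_D zero_in_D])

lemma lower_support_Delta: "lower_support \<Delta> y = (\<Sum>i\<in>UNIV. supp i y)"
  unfolding Delta_eq by (rule lower_support_minkowski_sum[OF compact_D D_nonempty])

lemma compact_Delta: "compact \<Delta>"
  using reflexive_Delta lattice_polytope_imp_compact unfolding reflexive_polytope_def by blast

lemma mem_dual_Delta_iff: "y \<in> dual_polytope \<Delta> \<longleftrightarrow> -1 \<le> (\<Sum>i\<in>UNIV. supp i y)"
proof -
  have "\<Delta> \<noteq> {}" using zero_in_interior_Delta interior_subset by blast
  then show ?thesis by (simp add: mem_dual_polytope_iff compact_Delta lower_support_Delta)
qed

lemma supp_sum_neg: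
  assumes "y \<noteq> 0"
  shows "(\<Sum>i\<in>UNIV. supp i y) < 0"
proof -
  obtain e where e: "0 < e" "ball 0 e \<subseteq> \<Delta>"
    using zero_in_interior_Delta mem_interior by blast
  define x where "x = (- (e / 2) / norm y) *\<^sub>R y"
  have "x \<in> \<Delta>" using e assms unfolding x_def by (intro subsetD[OF e(2)]) simp
  moreover have "x \<bullet> y < 0"
    using assms e unfolding x_def by (simp add: power2_norm_eq_inner[symmetric] power2_eq_square)
  ultimately show ?thesis using lower_support_le[OF compact_Delta, of x y] lower_support_Delta by simp
qed

definition V :: "'a set" where
  "V = (SOME S. finite S \<and> S \<subseteq> lattice_points \<and> dual_polytope \<Delta> = convex hull S)"

lemma V: "finite V" "V \<subseteq> lattice_points" "dual_polytope \<Delta> = convex hull V"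
proof -
  have "\<exists>S. finite S \<and> S \<subseteq> lattice_points \<and> dual_polytope \<Delta> = convex hull S"
    using reflexive_Delta unfolding reflexive_polytope_def lattice_polytope_def by blast
  then have "finite V \<and> V \<subseteq> lattice_points \<and> dual_polytope \<Delta> = convex hull V"
    unfolding V_def by (rule someI_ex)
  then show "finite V" "V \<subseteq> lattice_points" "dual_polytope \<Delta> = convex hull V" by auto
qed

lemma supp_sum_V_ge:
  assumes "s \<in> V"
  shows "-1 \<le> (\<Sum>i\<in>UNIV. supp i s)"
proof -
  have "s \<in> dual_polytope \<Delta>" unfolding V(3) using assms by (rule hull_inc)
  then show ?thesis using mem_dual_Delta_iff by blast
qed

text \<open>The supports of a lattice point of \<open>\<Delta>\<^sup>*\<close> are nonpositive integers adding up to at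
  least \<open>-1\<close>.\<close>
lemma V_cases:
  assumes "s \<in> V"
  obtains "s = 0" | i where "supp i s = -1" "\<And>j. j \<noteq> i \<Longrightarrow> supp j s = 0"
proof (cases "\<forall>i. supp i s = 0")
  case True
  then have "(\<Sum>i\<in>UNIV. supp i s) = 0" by simp
  then show thesis using supp_sum_neg that(1) by force
next
  case False
  then obtain i where "supp i s \<noteq> 0" by blast
  moreover have "supp i s \<in> \<int>"
    using lower_support_lattice_polytope_Ints[OF lattice_polytope_D D_nonempty] V(2) assms by blast
  ultimately have le: "supp i s \<le> -1" using Ints_nonzero_abs_ge1 supp_nonpos[of i s] by fastforce
  define e where "e j = (if j = i then -1 else 0 :: real)" for j
  have le_e: "supp j s \<le> e j" for j using le supp_nonpos by (simp add: e_def)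
  have eq: "(\<Sum>j\<in>UNIV. supp j s) = (\<Sum>j\<in>UNIV. e j)"
  proof (rule antisym)
    show "(\<Sum>j\<in>UNIV. supp j s) \<le> (\<Sum>j\<in>UNIV. e j)" using le_e by (rule sum_mono)
    show "(\<Sum>j\<in>UNIV. e j) \<le> (\<Sum>j\<in>UNIV. supp j s)" using supp_sum_V_ge[OF assms] by (simp add: e_def)
  qed
  have "supp j s = e j" for j using sum_mono_inv[OF eq le_e] by simp
  then show thesis using that(2)[of i] by (simp add: e_def)
qed

text \<open>Scale \<open>y\<close> onto the boundary of \<open>\<Delta>\<^sup>*\<close>: the superadditive \<open>supp i\<close> can only gain on the
  convex combination, while their sum is pinned down by \<open>-1\<close>.\<close>
lemma conic_decomposition:
  obtains l where "\<And>s. s \<in> V \<Longrightarrow> 0 \<le> l s" "y = (\<Sum>s\<in>V. l s *\<^sub>R s)"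
    "(\<Sum>s\<in>V. l s) = - (\<Sum>i\<in>UNIV. supp i y)" "\<And>i. supp i y = (\<Sum>s\<in>V. l s * supp i s)"
proof (cases "y = 0")
  case True
  then show thesis using that[of "\<lambda>_. 0"] by (simp add: lower_support_zero D_nonempty)
next
  case False
  define t where "t = - (\<Sum>i\<in>UNIV. supp i y)"
  have t: "0 < t" using supp_sum_neg[OF False] by (simp add: t_def)
  have "(\<Sum>i\<in>UNIV. supp i ((1 / t) *\<^sub>R y)) = (1 / t) * (\<Sum>i\<in>UNIV. supp i y)"
    using t by (simp add: lower_support_scaleR compact_D D_nonempty sum_distrib_left)
  also have "\<dots> = -1" using t by (simp add: t_def)
  finally have "(1 / t) *\<^sub>R y \<in> convex hull V" using mem_dual_Delta_iff V(3) by simp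
  then obtain u where u: "\<forall>s\<in>V. 0 \<le> u s" "sum u V = 1" "(\<Sum>s\<in>V. u s *\<^sub>R s) = (1 / t) *\<^sub>R y"
    using convex_hull_finite[OF V(1)] by auto
  define l where "l s = t * u s" for s
  have l0: "0 \<le> l s" if "s \<in> V" for s using u(1) t that by (simp add: l_def)
  have "(\<Sum>s\<in>V. l s *\<^sub>R s) = t *\<^sub>R (\<Sum>s\<in>V. u s *\<^sub>R s)"
    by (simp add: l_def scaleR_sum_right)
  then have y: "y = (\<Sum>s\<in>V. l s *\<^sub>R s)" using u(3) t by simp
  have lsum: "(\<Sum>s\<in>V. l s) = t"
    using u(2) by (simp add: l_def sum_distrib_left[symmetric])
  have le: "(\<Sum>s\<in>V. l s * supp i s) \<le> supp i y" for i
    unfolding y by (intro lower_support_sum_ge compact_D D_nonempty l0)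
  have "(\<Sum>i\<in>UNIV. supp i y) = (\<Sum>s\<in>V. l s * -1)" using lsum by (simp add: t_def sum_negf)
  also have "\<dots> \<le> (\<Sum>s\<in>V. l s * (\<Sum>i\<in>UNIV. supp i s))"
    by (intro sum_mono mult_left_mono supp_sum_V_ge l0)
  also have "\<dots> = (\<Sum>i\<in>UNIV. \<Sum>s\<in>V. l s * supp i s)"
    by (simp add: sum_distrib_left sum.swap[of _ V])
  finally have "(\<Sum>i\<in>UNIV. supp i y) \<le> (\<Sum>i\<in>UNIV. \<Sum>s\<in>V. l s * supp i s)" .
  moreover have "(\<Sum>i\<in>UNIV. \<Sum>s\<in>V. l s * supp i s) \<le> (\<Sum>i\<in>UNIV. supp i y)"
    by (intro sum_mono le)
  ultimately have eq: "(\<Sum>i\<in>UNIV. \<Sum>s\<in>V. l s * supp i s) = (\<Sum>i\<in>UNIV. supp i y)"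
    by (rule antisym[rotated])
  have "supp i y = (\<Sum>s\<in>V. l s * supp i s)" for i
    using sum_mono_inv[OF eq le] by simp
  with l0 y lsum show thesis by (intro that) (auto simp: t_def)
qed

lemma mem_nabla_iff: "y \<in> nabla i \<longleftrightarrow> (\<forall>j. - (if i = j then 1 else 0) \<le> supp j y)"
  by (rule mem_dual_nef_iff[OF compact_D D_nonempty])

lemma supp_nabla_ge: "y \<in> nabla i \<Longrightarrow> -1 \<le> supp i y"
  unfolding mem_nabla_iff by (metis (full_types))

lemma supp_nabla_off:
  assumes "y \<in> nabla i" "j \<noteq> i"
  shows "supp j y = 0"
proof -
  have "- (if i = j then 1 else 0) \<le> supp j y" using assms(1) mem_nabla_iff by blast
  then show ?thesis using assms(2) supp_nonpos[of j y] by simp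
qed

lemma V_index:
  obtains idx where "\<And>s j. s \<in> V \<Longrightarrow> supp j s \<noteq> 0 \<Longrightarrow> idx s = j"
proof -
  have "\<forall>s\<in>V. \<exists>i. \<forall>j. j \<noteq> i \<longrightarrow> supp j s = 0"
  proof
    fix s assume "s \<in> V"
    then show "\<exists>i. \<forall>j. j \<noteq> i \<longrightarrow> supp j s = 0"
      by (rule V_cases) (auto simp: lower_support_zero D_nonempty)
  qed
  from bchoice[OF this] obtain idx where "\<forall>s\<in>V. \<forall>j. j \<noteq> idx s \<longrightarrow> supp j s = 0" ..
  then show thesis by (intro that[of idx]) metis
qed

lemma V_mem_nabla:
  assumes "s \<in> V" "\<And>j. j \<noteq> i \<Longrightarrow> supp j s = 0"
  shows "s \<in> nabla i"
proof -
  have "(\<Sum>j\<in>UNIV. supp j s) = supp i s" using assms(2) by (rule sum_UNIV_eq_single)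
  then show ?thesis using supp_sum_V_ge[OF assms(1)] assms(2) by (auto simp: mem_nabla_iff)
qed

lemma V_subset_Union_nabla: "V \<subseteq> (\<Union>i. nabla i)"
proof -
  obtain idx where idx: "\<And>s j. s \<in> V \<Longrightarrow> supp j s \<noteq> 0 \<Longrightarrow> idx s = j"
    using V_index by blast
  have "s \<in> nabla (idx s)" if "s \<in> V" for s using that by (rule V_mem_nabla) (metis idx that)
  then show ?thesis by blast
qed

lemma nabla_subset_dual_Delta: "nabla i \<subseteq> dual_polytope \<Delta>"
proof
  fix y assume "y \<in> nabla i"
  then have "- (if i = j then 1 else 0) \<le> supp j y" for j using mem_nabla_iff by blast
  then have "(\<Sum>j\<in>UNIV. - (if i = j then 1 else 0)) \<le> (\<Sum>j\<in>UNIV. supp j y)" by (rule sum_mono)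
  then show "y \<in> dual_polytope \<Delta>" by (simp add: mem_dual_Delta_iff sum_negf)
qed

theorem convex_hull_Union_nabla: "convex hull (\<Union>i. nabla i) = dual_polytope \<Delta>"
proof
  show "convex hull (\<Union>i. nabla i) \<subseteq> dual_polytope \<Delta>"
    using nabla_subset_dual_Delta convex_dual_polytope by (intro hull_minimal) auto
  show "dual_polytope \<Delta> \<subseteq> convex hull (\<Union>i. nabla i)"
    unfolding V(3) by (rule hull_mono[OF V_subset_Union_nabla])
qed

text \<open>Grouping the conic decomposition by the index carrying each lattice point.\<close>
lemma mem_minkowski_sum_nabla:
  assumes "\<And>i. -1 \<le> supp i y"
  shows "y \<in> minkowski_sum nabla"
proof -
  obtain l where l0: "\<And>s. s \<in> V \<Longrightarrow> 0 \<le> l s" and y: "y = (\<Sum>s\<in>V. l s *\<^sub>R s)"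
    and "(\<Sum>s\<in>V. l s) = - (\<Sum>i\<in>UNIV. supp i y)"
    and additive: "\<And>i. supp i y = (\<Sum>s\<in>V. l s * supp i s)"
    using conic_decomposition[of y] by blast
  obtain idx where idx: "\<And>s j. s \<in> V \<Longrightarrow> supp j s \<noteq> 0 \<Longrightarrow> idx s = j"
    using V_index by blast
  define f where "f i = (\<Sum>s\<in>{s\<in>V. idx s = i}. l s *\<^sub>R s)" for i
  have "(\<Sum>i\<in>UNIV. f i) = y"
    unfolding f_def y using V(1) by (intro sum.group) auto
  moreover have "f i \<in> nabla i" for i
    unfolding mem_nabla_iff
  proof
    fix j
    have ge: "(\<Sum>s\<in>{s\<in>V. idx s = i}. l s * supp j s) \<le> supp j (f i)"
      unfolding f_def by (intro lower_support_sum_ge compact_D D_nonempty l0) blast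
    show "- (if i = j then 1 else 0) \<le> supp j (f i)"
    proof (cases "i = j")
      case True
      have "(\<Sum>s\<in>{s\<in>V. idx s = i}. l s * supp j s) = supp j y"
        unfolding additive using V(1) True by (intro sum.mono_neutral_left) (auto intro: idx)
      then show ?thesis using ge assms[of j] True by simp
    next
      case False
      have "(\<Sum>s\<in>{s\<in>V. idx s = i}. l s * supp j s) = 0"
        using False by (intro sum.neutral) (auto dest: idx)
      then show ?thesis using ge False by simp
    qed
  qed
  ultimately show ?thesis unfolding minkowski_sum_def by blast
qed

lemma lattice_polytope_C: "lattice_polytope C"
  by (rule lattice_polytope_convex_hull_Union[OF lattice_polytope_D])

lemma compact_C: "compact C"
  by (rule lattice_polytope_imp_compact[OF lattice_polytope_C])

lemma D_subset_C: "D i \<subseteq> C"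
  by (auto intro: hull_inc)

lemma dual_polytope_C: "dual_polytope C = minkowski_sum nabla"
proof
  show "dual_polytope C \<subseteq> minkowski_sum nabla"
  proof
    fix y assume "y \<in> dual_polytope C"
    then have "\<forall>x\<in>D i. -1 \<le> x \<bullet> y" for i using D_subset_C unfolding dual_polytope_def by blast
    then have "-1 \<le> supp i y" for i using lower_support_ge_iff[OF compact_D D_nonempty] by blast
    then show "y \<in> minkowski_sum nabla" by (rule mem_minkowski_sum_nabla)
  qed
  show "minkowski_sum nabla \<subseteq> dual_polytope C"
  proof
    fix y assume "y \<in> minkowski_sum nabla"
    then obtain f where y: "y = (\<Sum>j\<in>UNIV. f j)" and f: "\<And>j. f j \<in> nabla j"
      unfolding minkowski_sum_def by blast
    have "-1 \<le> x \<bullet> y" if "x \<in> D i" for x i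
    proof -
      have "(\<Sum>j\<in>UNIV. - (if j = i then 1 else 0)) \<le> (\<Sum>j\<in>UNIV. x \<bullet> f j)"
        using f that unfolding dual_nef_def by (intro sum_mono) blast
      then show ?thesis by (simp add: y inner_sum_right sum_negf)
    qed
    then have "y \<in> dual_polytope (\<Union>i. D i)" unfolding dual_polytope_def by blast
    then show "y \<in> dual_polytope C" by (simp add: dual_polytope_convex_hull)
  qed
qed

theorem C_eq_dual_polytope_nabla: "C = dual_polytope (minkowski_sum nabla)"
proof -
  have "0 \<in> C" using D_subset_C zero_in_D by blast
  then show ?thesis
    using dual_dual_polytope[of C] compact_C dual_polytope_C by (simp add: compact_imp_closed)
qed

lemma nabla_eq_convex_hull: "nabla i = convex hull (insert 0 (V \<inter> nabla i))"
proof
  show "convex hull (insert 0 (V \<inter> nabla i)) \<subseteq> nabla i"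
    using zero_in_dual_nef convex_dual_nef by (intro hull_minimal) auto
  show "nabla i \<subseteq> convex hull (insert 0 (V \<inter> nabla i))"
  proof
    fix y assume y: "y \<in> nabla i"
    obtain l where l0: "\<And>s. s \<in> V \<Longrightarrow> 0 \<le> l s" and y_eq: "y = (\<Sum>s\<in>V. l s *\<^sub>R s)"
      and lsum: "(\<Sum>s\<in>V. l s) = - (\<Sum>j\<in>UNIV. supp j y)"
      and additive: "\<And>j. supp j y = (\<Sum>s\<in>V. l s * supp j s)"
      using conic_decomposition[of y] by blast
    have vanish: "l s * supp j s = 0" if "j \<noteq> i" "s \<in> V" for j s
    proof (rule sum_mono_inv[of "\<lambda>s. l s * supp j s" V "\<lambda>_. 0"])
      show "(\<Sum>s\<in>V. l s * supp j s) = (\<Sum>s\<in>V. 0)"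
        using additive[of j] supp_nabla_off[OF y that(1)] by simp
    qed (use l0 supp_nonpos V(1) that(2) in \<open>auto intro: mult_nonneg_nonpos\<close>)
    have "(\<Sum>j\<in>UNIV. supp j y) = supp i y"
      using supp_nabla_off[OF y] by (rule sum_UNIV_eq_single)
    then have l1: "(\<Sum>s\<in>V. l s) \<le> 1" using lsum supp_nabla_ge[OF y] by simp
    define W where "W = {s \<in> V. l s \<noteq> 0}"
    have W: "W \<subseteq> V \<inter> nabla i"
    proof
      fix s assume "s \<in> W"
      then have s: "s \<in> V" "l s \<noteq> 0" unfolding W_def by auto
      then have "s \<in> nabla i" using vanish by (intro V_mem_nabla) auto
      then show "s \<in> V \<inter> nabla i" using s(1) by simp
    qed
    have y_W: "y = (\<Sum>s\<in>W. l s *\<^sub>R s)"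
      unfolding y_eq W_def using V(1) by (intro sum.mono_neutral_right) auto
    have "(\<Sum>s\<in>W. l s) = (\<Sum>s\<in>V. l s)"
      unfolding W_def using V(1) by (intro sum.mono_neutral_left) auto
    then have W1: "(\<Sum>s\<in>W. l s) \<le> 1" using l1 by simp
    show "y \<in> convex hull (insert 0 (V \<inter> nabla i))" unfolding y_W
      by (rule convex_sum_le_one_mem[OF convex_convex_hull _ _ _ W1])
        (use W l0 V(1) in \<open>auto simp: W_def intro: hull_inc\<close>)
  qed
qed

lemma lattice_polytope_nabla: "lattice_polytope (nabla i)"
proof -
  have "finite (insert 0 (V \<inter> nabla i))" "insert 0 (V \<inter> nabla i) \<subseteq> lattice_points"
    using V(1,2) zero_in_lattice_points by auto
  then show ?thesis unfolding lattice_polytope_def using nabla_eq_convex_hull by blast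
qed

lemma compact_nabla: "compact (nabla i)"
  by (rule lattice_polytope_imp_compact[OF lattice_polytope_nabla])

lemma scaled_Delta_subset_C: "(*\<^sub>R) (1 / real CARD('r)) ` \<Delta> \<subseteq> C"
proof
  fix z assume "z \<in> (*\<^sub>R) (1 / real CARD('r)) ` \<Delta>"
  then obtain f where z: "z = (1 / real CARD('r)) *\<^sub>R (\<Sum>i\<in>UNIV. f i)" and f: "\<And>i. f i \<in> D i"
    unfolding Delta_eq minkowski_sum_def by blast
  have "(\<Sum>i\<in>UNIV. (1 / real CARD('r)) *\<^sub>R f i) \<in> C"
    using f D_subset_C by (intro convex_sum) auto
  then show "z \<in> C" unfolding z by (simp add: scaleR_sum_right)
qed

lemma zero_in_interior_C: "0 \<in> interior C"
proof -
  let ?c = "1 / real CARD('r)"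
  have "open ((*\<^sub>R) ?c ` interior \<Delta>)" by (intro open_scaling) auto
  moreover have "(*\<^sub>R) ?c ` interior \<Delta> \<subseteq> C"
    using scaled_Delta_subset_C interior_subset by blast
  ultimately have "(*\<^sub>R) ?c ` interior \<Delta> \<subseteq> interior C" by (rule interior_maximal[rotated])
  moreover have "0 \<in> (*\<^sub>R) ?c ` interior \<Delta>" using zero_in_interior_Delta by force
  ultimately show ?thesis by blast
qed

theorem reflexive_C: "reflexive_polytope C"
  unfolding reflexive_polytope_def dual_polytope_C
  using lattice_polytope_C zero_in_interior_C lattice_polytope_minkowski_sum[of nabla] lattice_polytope_nabla
  by blast

subsection \<open>Ehrhart series\<close>

lemma weighted_supp_V_le:
  assumes "s \<in> V" "\<And>i. - a i \<le> lower_support (nabla i) m"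
  shows "(\<Sum>i\<in>UNIV. a i * supp i s) \<le> s \<bullet> m"
  using assms(1)
proof (rule V_cases)
  show "s = 0 \<Longrightarrow> ?thesis" by (simp add: lower_support_zero D_nonempty)
  fix i assume i: "supp i s = -1" "\<And>j. j \<noteq> i \<Longrightarrow> supp j s = 0"
  then have "s \<in> nabla i" unfolding mem_nabla_iff by simp
  then have "lower_support (nabla i) m \<le> s \<bullet> m" by (rule lower_support_le[OF compact_nabla])
  moreover have "(\<Sum>j\<in>UNIV. a j * supp j s) = - a i"
    using i by (subst sum_UNIV_eq_single[of i]) auto
  ultimately show ?thesis using assms(2)[of i] by simp
qed

lemma weighted_supp_le_inner:
  assumes "\<And>i. 0 \<le> a i" "\<And>i. - a i \<le> lower_support (nabla i) m"
  shows "(\<Sum>i\<in>UNIV. a i * supp i w) \<le> w \<bullet> m"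
proof -
  obtain l where l0: "\<And>s. s \<in> V \<Longrightarrow> 0 \<le> l s" and w: "w = (\<Sum>s\<in>V. l s *\<^sub>R s)"
    and "(\<Sum>s\<in>V. l s) = - (\<Sum>i\<in>UNIV. supp i w)"
    and additive: "\<And>i. supp i w = (\<Sum>s\<in>V. l s * supp i s)"
    using conic_decomposition[of w] by blast
  have "(\<Sum>i\<in>UNIV. a i * supp i w) = (\<Sum>s\<in>V. l s * (\<Sum>i\<in>UNIV. a i * supp i s))"
    by (simp add: additive sum_distrib_left sum.swap[of _ V] mult_ac)
  also have "\<dots> \<le> (\<Sum>s\<in>V. l s * (s \<bullet> m))"
    using assms(2) by (intro sum_mono mult_left_mono weighted_supp_V_le l0)
  also have "\<dots> = w \<bullet> m" by (simp add: w inner_sum_left)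
  finally show ?thesis .
qed

lemma lower_support_nabla_weighted_sum:
  assumes a: "\<And>j. 0 \<le> a j" and x: "\<And>j. x j \<in> D j"
  shows "- a i \<le> lower_support (nabla i) (\<Sum>j\<in>UNIV. a j *\<^sub>R x j)"
proof -
  have "- a i \<le> y \<bullet> (\<Sum>j\<in>UNIV. a j *\<^sub>R x j)" if "y \<in> nabla i" for y
  proof -
    have "(\<Sum>j\<in>UNIV. a j * - (if i = j then 1 else 0)) \<le> (\<Sum>j\<in>UNIV. a j * (x j \<bullet> y))"
      using that x unfolding dual_nef_def by (intro sum_mono mult_left_mono a) blast
    moreover have "(\<Sum>j\<in>UNIV. a j * - (if i = j then 1 else 0)) = - a i"
      by (subst sum_UNIV_eq_single[of i]) auto
    ultimately show ?thesis by (simp add: inner_sum_right inner_commute)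
  qed
  then show ?thesis using lower_support_ge_iff[OF compact_nabla] zero_in_dual_nef by blast
qed

lemma ex_weighted_sum_D:
  assumes a: "\<And>i. 0 \<le> a i" and bound: "\<And>i. - a i \<le> lower_support (nabla i) m"
  shows "\<exists>x. (\<forall>i. x i \<in> D i) \<and> m = (\<Sum>i\<in>UNIV. a i *\<^sub>R x i)"
proof (rule ccontr)
  let ?K = "minkowski_sum (\<lambda>i. (*\<^sub>R) (a i) ` D i)"
  have K: "polytope ?K"
    by (intro polytope_minkowski_sum polytope_scaling lattice_polytope_imp_polytope lattice_polytope_D)
  assume "\<nexists>x. (\<forall>i. x i \<in> D i) \<and> m = (\<Sum>i\<in>UNIV. a i *\<^sub>R x i)"
  then have "m \<notin> ?K" by (simp add: mem_minkowski_sum_scaleR_iff)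
  then obtain w b where sep: "w \<bullet> m < b" "\<And>p. p \<in> ?K \<Longrightarrow> b < w \<bullet> p"
    using separating_hyperplane_closed_point[OF polytope_imp_convex[OF K] polytope_imp_closed[OF K]]
    by blast
  have "\<forall>i. \<exists>x. x \<in> D i \<and> x \<bullet> w = supp i w"
    using lower_support_attained[OF compact_D D_nonempty] by blast
  from choice[OF this] obtain x where x: "\<And>i. x i \<in> D i" "\<And>i. x i \<bullet> w = supp i w" by blast
  have "(\<Sum>i\<in>UNIV. a i *\<^sub>R x i) \<in> ?K"
    unfolding mem_minkowski_sum_scaleR_iff using x(1) by blast
  then have "w \<bullet> m < (\<Sum>i\<in>UNIV. a i * supp i w)"
    using sep x(2) by (fastforce simp: inner_sum_right inner_commute)
  then show False using weighted_supp_le_inner[OF a bound, of w] by simp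
qed

lemma ex_weighted_sum_D_iff:
  assumes "\<And>i. 0 \<le> a i"
  shows "(\<exists>x. (\<forall>i. x i \<in> D i) \<and> m = (\<Sum>i\<in>UNIV. a i *\<^sub>R x i))
    \<longleftrightarrow> (\<forall>i. - a i \<le> lower_support (nabla i) m)"
  using assms ex_weighted_sum_D lower_support_nabla_weighted_sum by blast

lemma mem_scaleR_C_iff:
  assumes "0 \<le> t"
  shows "m \<in> (*\<^sub>R) t ` C \<longleftrightarrow> (\<Sum>i\<in>UNIV. - lower_support (nabla i) m) \<le> t"
proof
  assume "m \<in> (*\<^sub>R) t ` C"
  then obtain a :: "'r \<Rightarrow> real" and x where a: "\<forall>i. 0 \<le> a i" "sum a UNIV = t"
    and x: "\<forall>i. x i \<in> D i" and m: "m = (\<Sum>i\<in>UNIV. a i *\<^sub>R x i)"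
    unfolding scaleR_convex_hull_Union[OF convex_D D_nonempty assms] by blast
  then have "\<forall>i. - a i \<le> lower_support (nabla i) m" using ex_weighted_sum_D_iff[of a m] by blast
  then have "- lower_support (nabla i) m \<le> a i" for i by (metis minus_le_iff)
  then have "(\<Sum>i\<in>UNIV. - lower_support (nabla i) m) \<le> sum a UNIV" by (rule sum_mono)
  then show "(\<Sum>i\<in>UNIV. - lower_support (nabla i) m) \<le> t" using a(2) by simp
next
  assume le: "(\<Sum>i\<in>UNIV. - lower_support (nabla i) m) \<le> t"
  define b where "b i = - lower_support (nabla i) m" for i
  define a where "a i = b i + (t - sum b UNIV) / real CARD('r)" for i
  have b0: "0 \<le> b i" for i
    using lower_support_nonpos[OF compact_nabla zero_in_dual_nef] by (simp add: b_def)
  have slack: "0 \<le> (t - sum b UNIV) / real CARD('r)" using le by (simp add: b_def)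
  have a0: "0 \<le> a i" for i using b0 slack by (simp add: a_def)
  have "sum a UNIV = t" by (simp add: a_def sum.distrib)
  moreover have "- a i \<le> lower_support (nabla i) m" for i using slack by (simp add: a_def b_def)
  then obtain x where "\<forall>i. x i \<in> D i" "m = (\<Sum>i\<in>UNIV. a i *\<^sub>R x i)"
    using ex_weighted_sum_D_iff[of a m] a0 by blast
  ultimately show "m \<in> (*\<^sub>R) t ` C"
    unfolding scaleR_convex_hull_Union[OF convex_D D_nonempty assms] using a0 by blast
qed

lemma scaleR_cayley_eq:
  assumes "0 \<le> t"
  shows "(*\<^sub>R) t ` cayley D = {(\<Sum>i\<in>UNIV. a i *\<^sub>R x i, \<chi> i. a i) | a x.
    (\<forall>i. 0 \<le> a i) \<and> sum a UNIV = t \<and> (\<forall>i. x i \<in> D i)}"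
proof -
  let ?K = "\<lambda>i. (\<lambda>x. (x, axis i 1 :: real^'r)) ` D i"
  have K: "?K i = D i \<times> {axis i 1}" for i by auto
  have "convex (?K i)" "?K i \<noteq> {}" for i
    unfolding K by (simp_all add: convex_Times convex_D D_nonempty)
  then have "(*\<^sub>R) t ` cayley D = {\<Sum>i\<in>UNIV. a i *\<^sub>R p i | a p.
      (\<forall>i. 0 \<le> a i) \<and> sum a UNIV = t \<and> (\<forall>i. p i \<in> ?K i)}"
    unfolding cayley_def by (rule scaleR_convex_hull_Union[OF _ _ assms])
  also have "\<dots> = {\<Sum>i\<in>UNIV. a i *\<^sub>R (x i, axis i 1) | a x.
      (\<forall>i. 0 \<le> a i) \<and> sum a UNIV = t \<and> (\<forall>i. x i \<in> D i)}"
    by (rule weighted_sums_image)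
  finally show ?thesis by (simp only: sum_scaleR_Pair_axis)
qed

lemma mem_scaleR_cayley_iff:
  assumes "0 \<le> t"
  shows "(m, v) \<in> (*\<^sub>R) t ` cayley D \<longleftrightarrow>
    (\<forall>i. 0 \<le> v $ i) \<and> (\<Sum>i\<in>UNIV. v $ i) = t \<and> (\<forall>i. - v $ i \<le> lower_support (nabla i) m)"
proof -
  have "(m, v) \<in> (*\<^sub>R) t ` cayley D \<longleftrightarrow> (\<exists>a. (\<forall>i. 0 \<le> a i) \<and> sum a UNIV = t \<and> v = (\<chi> i. a i)
      \<and> (\<exists>x. (\<forall>i. x i \<in> D i) \<and> m = (\<Sum>i\<in>UNIV. a i *\<^sub>R x i)))"
    unfolding scaleR_cayley_eq[OF assms] by blast
  also have "\<dots> \<longleftrightarrow> (\<forall>i. 0 \<le> v $ i) \<and> (\<Sum>i\<in>UNIV. v $ i) = t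
      \<and> (\<exists>x. (\<forall>i. x i \<in> D i) \<and> m = (\<Sum>i\<in>UNIV. v $ i *\<^sub>R x i))"
    by (auto simp: vec_eq_iff intro!: exI[of _ "\<lambda>i. v $ i"])
  also have "\<dots> \<longleftrightarrow> (\<forall>i. 0 \<le> v $ i) \<and> (\<Sum>i\<in>UNIV. v $ i) = t \<and> (\<forall>i. - v $ i \<le> lower_support (nabla i) m)"
    using ex_weighted_sum_D_iff[of "\<lambda>i. v $ i" m] by blast
  finally show ?thesis .
qed

text \<open>By \<open>ex_weighted_sum_D_iff\<close>, a lattice point \<open>m\<close> lies in \<open>\<Sum>\<^sub>i a\<^sub>i D\<^sub>i\<close> iff
  \<open>height i m \<le> a\<^sub>i\<close> for all \<open>i\<close>.\<close>
definition height :: "'r \<Rightarrow> 'a \<Rightarrow> nat" where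
  "height i m = nat \<lceil>- lower_support (nabla i) m\<rceil>"

abbreviation total_height :: "'a \<Rightarrow> nat" where
  "total_height m \<equiv> \<Sum>i\<in>UNIV. height i m"

lemma of_nat_height:
  assumes "m \<in> lattice_points"
  shows "real (height i m) = - lower_support (nabla i) m"
proof -
  have "lower_support (nabla i) m \<in> \<int>"
    using lower_support_lattice_polytope_Ints[OF lattice_polytope_nabla _ assms] zero_in_dual_nef
    by blast
  moreover have "lower_support (nabla i) m \<le> 0"
    by (rule lower_support_nonpos[OF compact_nabla zero_in_dual_nef])
  ultimately show ?thesis unfolding height_def by (auto elim!: Ints_cases)
qed

lemma lattice_points_scaleR_C:
  "lattice_points \<inter> (*\<^sub>R) (real j) ` C = {m \<in> lattice_points. total_height m \<le> j}"
proof -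
  have "m \<in> (*\<^sub>R) (real j) ` C \<longleftrightarrow> total_height m \<le> j" if "m \<in> lattice_points" for m
  proof -
    have "real (total_height m) = (\<Sum>i\<in>UNIV. - lower_support (nabla i) m)"
      using of_nat_height[OF that] by simp
    then show ?thesis using mem_scaleR_C_iff[of "real j" m] by (metis of_nat_0_le_iff of_nat_le_iff)
  qed
  then show ?thesis by blast
qed

lemma finite_total_height_le: "finite {m \<in> lattice_points. total_height m \<le> j}"
  unfolding lattice_points_scaleR_C[symmetric]
  by (intro finite_lattice_points_Int_bounded compact_imp_bounded compact_scaling compact_C)

lemma lattice_points_scaleR_cayley:
  "lattice_points \<inter> (*\<^sub>R) (real j) ` cayley D
    = (\<lambda>(m, c). (m, \<chi> i. real (height i m + c i))) `
        (SIGMA m:{m \<in> lattice_points. total_height m \<le> j}.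
          weak_compositions UNIV (j - total_height m))"
  (is "_ = ?\<Phi> ` ?S")
proof (intro set_eqI iffI)
  fix p assume "p \<in> ?\<Phi> ` ?S"
  then obtain m c where m: "m \<in> lattice_points" "total_height m \<le> j"
    and c: "sum c UNIV = j - total_height m" and p: "p = (m, \<chi> i. real (height i m + c i))"
    by (auto simp: weak_compositions_def)
  have "(\<Sum>i\<in>UNIV. real (height i m + c i)) = real j"
    using m(2) c by (simp add: sum.distrib flip: of_nat_sum)
  moreover have "- real (height i m + c i) \<le> lower_support (nabla i) m" for i
    using of_nat_height[OF m(1), of i] by simp
  ultimately have "p \<in> (*\<^sub>R) (real j) ` cayley D"
    unfolding p mem_scaleR_cayley_iff[OF of_nat_0_le_iff] by simp
  moreover have "p \<in> lattice_points"
    unfolding p Pair_in_lattice_points_iff vec_in_lattice_points_iff using m(1) by simp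
  ultimately show "p \<in> lattice_points \<inter> (*\<^sub>R) (real j) ` cayley D" by blast
next
  fix p assume "p \<in> lattice_points \<inter> (*\<^sub>R) (real j) ` cayley D"
  then obtain m v where p: "p = (m, v)" and m: "m \<in> lattice_points" and vZ: "\<And>i. v $ i \<in> \<int>"
    and v0: "\<And>i. 0 \<le> v $ i" and vsum: "(\<Sum>i\<in>UNIV. v $ i) = real j"
    and vh: "\<And>i. - v $ i \<le> lower_support (nabla i) m"
    by (cases p) (auto simp: Pair_in_lattice_points_iff vec_in_lattice_points_iff mem_scaleR_cayley_iff)
  define n where "n i = nat \<lfloor>v $ i\<rfloor>" for i
  have n: "real (n i) = v $ i" for i using vZ[of i] v0[of i] by (auto simp: n_def elim!: Ints_cases)
  have hn: "height i m \<le> n i" for i using vh[of i] of_nat_height[OF m, of i] n[of i] by simp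
  have "real (sum n UNIV) = real j" using vsum n by simp
  then have nsum: "sum n UNIV = j" by (simp only: of_nat_eq_iff)
  define c where "c i = n i - height i m" for i
  have "total_height m \<le> j" using nsum hn by (metis sum_mono)
  moreover have "sum c UNIV = j - total_height m"
    using hn nsum by (simp add: c_def sum_subtractf_nat)
  moreover have "p = ?\<Phi> (m, c)" using hn n by (simp add: p c_def vec_eq_iff)
  ultimately show "p \<in> ?\<Phi> ` ?S" using m by (auto simp: weak_compositions_def)
qed

lemma inj_lattice_points_cayley_param: "inj (\<lambda>(m, c). (m, \<chi> i. real (height i m + c i)))"
  by (auto intro!: injI simp: vec_eq_iff fun_eq_iff)

definition level_count :: "nat \<Rightarrow> nat" where
  "level_count n = card {m \<in> lattice_points. total_height m = n}"

lemma sum_over_total_height_le: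
  "(\<Sum>m\<in>{m \<in> lattice_points. total_height m \<le> j}. g (total_height m))
    = (\<Sum>n\<le>j. level_count n * g n)"
proof -
  let ?A = "{m \<in> lattice_points. total_height m \<le> j}"
  have "(\<Sum>m\<in>?A. g (total_height m))
      = (\<Sum>n\<le>j. \<Sum>m\<in>{m \<in> ?A. total_height m = n}. g (total_height m))"
    using finite_total_height_le by (intro sum.group[symmetric]) auto
  also have "\<dots> = (\<Sum>n\<le>j. level_count n * g n)"
  proof (rule sum.cong[OF refl])
    fix n assume "n \<in> {..j}"
    then have "{m \<in> ?A. total_height m = n} = {m \<in> lattice_points. total_height m = n}"
      by auto
    then show "(\<Sum>m\<in>{m \<in> ?A. total_height m = n}. g (total_height m))
        = level_count n * g n"
      by (simp add: level_count_def)
  qed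
  finally show ?thesis .
qed

lemma ehrhart_series_C: "ehrhart_series C = Abs_fps (\<lambda>n. int (level_count n)) * Abs_fps (\<lambda>_. 1)"
proof (rule fps_ext)
  fix j
  have "card (lattice_points \<inter> (*\<^sub>R) (real j) ` C) = (\<Sum>n\<le>j. level_count n)"
    using sum_over_total_height_le[where g = "\<lambda>_. 1" and j = j] by (simp add: lattice_points_scaleR_C)
  then show "fps_nth (ehrhart_series C) j
      = fps_nth (Abs_fps (\<lambda>n. int (level_count n)) * Abs_fps (\<lambda>_. 1)) j"
    by (simp add: ehrhart_series_def fps_mult_nth atLeast0AtMost)
qed

lemma ehrhart_series_cayley:
  "ehrhart_series (cayley D) = Abs_fps (\<lambda>n. int (level_count n)) * Abs_fps (\<lambda>_. 1) ^ CARD('r)"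
proof (rule fps_ext)
  fix j
  let ?A = "{m \<in> lattice_points. total_height m \<le> j}"
  let ?W = "\<lambda>n. card (weak_compositions (UNIV :: 'r set) n)"
  have "card (lattice_points \<inter> (*\<^sub>R) (real j) ` cayley D)
      = card (SIGMA m:?A. weak_compositions (UNIV :: 'r set) (j - total_height m))"
    unfolding lattice_points_scaleR_cayley
    using inj_on_subset[OF inj_lattice_points_cayley_param subset_UNIV] by (rule card_image)
  also have "\<dots> = (\<Sum>m\<in>?A. ?W (j - total_height m))"
    by (simp add: finite_total_height_le finite_weak_compositions)
  also have "\<dots> = (\<Sum>n\<le>j. level_count n * ?W (j - n))"
    by (rule sum_over_total_height_le)
  finally show "fps_nth (ehrhart_series (cayley D)) j
      = fps_nth (Abs_fps (\<lambda>n. int (level_count n)) * Abs_fps (\<lambda>_. 1) ^ CARD('r)) j"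
    by (simp add: ehrhart_series_def fps_mult_nth atLeast0AtMost
        flip: fps_card_weak_compositions[of "UNIV :: 'r set", simplified])
qed

lemma aff_dim_C: "aff_dim C = DIM('a)"
  using zero_in_interior_C by (intro aff_dim_nonempty_interior) blast

lemma cayley_eq: "cayley D = {(\<Sum>i\<in>UNIV. a i *\<^sub>R x i, \<chi> i. a i) | a x.
    (\<forall>i. 0 \<le> a i) \<and> sum a UNIV = 1 \<and> (\<forall>i. x i \<in> D i)}"
  using scaleR_cayley_eq[of 1] by simp

lemma scaled_Delta_mem_cayley:
  assumes "x \<in> \<Delta>"
  shows "((1 / real CARD('r)) *\<^sub>R x, \<chi> i. 1 / real CARD('r)) \<in> cayley D"
proof -
  obtain f where x: "x = (\<Sum>i\<in>UNIV. f i)" and f: "\<And>i. f i \<in> D i"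
    using assms unfolding Delta_eq minkowski_sum_def by blast
  show ?thesis unfolding cayley_eq x scaleR_sum_right using f
    by (intro CollectI exI[of _ "\<lambda>_. 1 / real CARD('r)"] exI[of _ f]) simp
qed

lemma axis_mem_cayley: "(0, axis i 1) \<in> cayley D"
  unfolding cayley_eq using zero_in_D
  by (intro CollectI exI[of _ "\<lambda>j. if j = i then 1 else 0"] exI[of _ "\<lambda>_. 0"]) (simp add: axis_def)

lemma Pair_centre_mem_affine_hull_cayley:
  "(z, \<chi> i. 1 / real CARD('r)) \<in> affine hull (cayley D)"
proof -
  let ?r = "real CARD('r)" and ?u = "\<chi> i. 1 / real CARD('r)"
  have u: "(0, ?u) \<in> affine hull (cayley D)"
    using scaled_Delta_mem_cayley[OF subsetD[OF interior_subset zero_in_interior_Delta]]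
    by (simp add: hull_inc)
  obtain c where c: "0 < c" "c *\<^sub>R z \<in> \<Delta>"
    using zero_in_interior_absorbing[OF zero_in_interior_Delta] by blast
  have "(0, ?u) + (?r / c) *\<^sub>R (((1 / ?r) *\<^sub>R (c *\<^sub>R z), ?u) - (0, ?u)) \<in> affine hull (cayley D)"
    using scaled_Delta_mem_cayley[OF c(2)] by (intro mem_affine_3_minus affine_affine_hull u hull_inc)
  then show ?thesis using c(1) by simp
qed

lemma affine_hull_cayley: "affine hull (cayley D) = {p. (0, \<chi> i. 1) \<bullet> p = 1}"
proof
  have "cayley D \<subseteq> {p. (0, \<chi> i. 1) \<bullet> p = 1}"
    unfolding cayley_eq by (auto simp: inner_Pair inner_vec_def)
  then show "affine hull (cayley D) \<subseteq> {p. (0, \<chi> i. 1) \<bullet> p = 1}"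
    by (rule hull_minimal) (rule affine_hyperplane)
next
  let ?u = "\<chi> i. 1 / real CARD('r)"
  show "{p. (0, \<chi> i. 1) \<bullet> p = 1} \<subseteq> affine hull (cayley D)"
  proof clarify
    fix z :: 'a and v :: "real^'r" assume "(0, \<chi> i. 1) \<bullet> (z, v) = 1"
    then have v: "(\<Sum>i\<in>UNIV. v $ i) = 1" by (simp add: inner_Pair inner_vec_def)
    have "(\<Sum>i\<in>UNIV. v $ i *\<^sub>R (axis i 1 - ?u)) = v - ?u"
      using v sum_scaleR_axis[of "\<lambda>i. v $ i"]
      by (simp add: scaleR_diff_right sum_subtractf scaleR_sum_left[symmetric])
    then have "(z, v) = (z, ?u) + (\<Sum>i\<in>UNIV. v $ i *\<^sub>R ((0, axis i 1) - (0, ?u)))"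
      by (simp add: prod_eq_iff fst_sum snd_sum)
    also have "\<dots> \<in> affine hull (cayley D)"
      by (intro mem_affine_add_sum_diffs affine_affine_hull Pair_centre_mem_affine_hull_cayley
          hull_inc axis_mem_cayley) simp
    finally show "(z, v) \<in> affine hull (cayley D)" .
  qed
qed

lemma aff_dim_cayley: "aff_dim (cayley D) = int (DIM('a) + CARD('r)) - 1"
proof -
  have "((0 :: 'a), (\<chi> i. 1) :: real^'r) \<noteq> 0" by (simp add: prod_eq_iff vec_eq_iff)
  then have "aff_dim (affine hull (cayley D)) = DIM('a \<times> (real^'r)) - 1"
    unfolding affine_hull_cayley by (rule aff_dim_hyperplane)
  then show ?thesis using DIM_positive[where 'a = 'a] by (simp add: of_nat_diff)
qed

theorem h_star_cayley_eq_h_star_C: "h_star (cayley D) = h_star C"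
proof -
  let ?G = "Abs_fps (\<lambda>n. int (level_count n))" and ?ones = "Abs_fps (\<lambda>_. 1 :: int)"
    and ?Y = "1 - fps_X :: int fps"
  have "nat (aff_dim (cayley D)) + 1 = DIM('a) + CARD('r)"
    unfolding aff_dim_cayley using DIM_positive[where 'a = 'a] by linarith
  then have "h_star (cayley D) = ?Y ^ DIM('a) * ?G * (?Y * ?ones) ^ CARD('r)"
    unfolding h_star_def ehrhart_series_cayley by (simp only: power_add power_mult_distrib ac_simps)
  also have "\<dots> = ?Y ^ DIM('a) * ?G * (?Y * ?ones)"
    by (simp only: one_minus_X_mult_ones power_one mult_1_right)
  also have "\<dots> = h_star C"
    unfolding h_star_def ehrhart_series_C aff_dim_C by (simp only: nat_int power_add power_one_right ac_simps)
  finally show ?thesis .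
qed

end

theorem proposition3p16:
  fixes \<Delta> :: "'a::euclidean_space set" and D :: "'r::finite \<Rightarrow> 'a set"
  assumes "centered_nef_partition \<Delta> D"
  shows "reflexive_polytope (convex hull (\<Union>i. D i))
    \<and> convex hull (\<Union>i. D i) = dual_polytope (minkowski_sum (dual_nef D))
    \<and> convex hull (\<Union>i. dual_nef D i) = dual_polytope \<Delta>
    \<and> h_star (cayley D) = h_star (convex hull (\<Union>i. D i))"
proof -
  interpret nef_partition \<Delta> D by (rule nef_partition.intro) (rule assms)
  show ?thesis
    using reflexive_C C_eq_dual_polytope_nabla convex_hull_Union_nabla h_star_cayley_eq_h_star_C
    by blast
qed

end
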